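(* Let $G$ be a graph on at least three vertices. Let $k\ge 1$ be an integer, and let $a\ge 1$ be an integer with $a\ge \widetilde{\alpha}(G)$. If $$ \delta(G)\ge \max_{0\le i\le k-1}\bigl(2i+\Phi(a,2i)\bigr), $$ where $i$ ranges over integers, then $G$ contains $k$ pairwise edge-disjoint Hamilton cycles.
   Context: All graphs are finite and simple. $\delta(G)$ denotes the minimum degree of $G$. Given positive integers $s,t$, an $(s,t)$-bipartite hole in a graph $G$ is a pair of disjoint vertex sets $S,T \subseteq V(G)$ with $|S|=s$, $|T|=t$, and no edge of $G$ between $S$ and $T$. The bipartite-hole-number $\widetilde{\alpha}(G)$ is the least integer $r$ that can be written as $r=s+t-1$ for some positive integers $s,t$ such that $G$ contains no $(s,t)$-bipartite hole. For integers $a\ge 1$ and $D\ge 0$, define $\Phi(a,D)$ as follows: $\Phi(a,0)=a$, and, for $D\ge 1$, $$ \Phi(a,D)=\max_{1\le s\le \lfloor (a+1)/2\rfloor}\ \min_{\substack{x\in\mathbb{N}\\ x\ge 2s+2D}}\left(x+\left\lceil (a+1-s)\exp\left(\frac{4sD}{x}\right)\right\rceil-1\right), $$ where $s$ ranges over integers. *)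

theory Defs
  imports Complex_Main
begin

text \<open>A finite simple graph is given by its vertex set \<open>V\<close> and its edge set \<open>E\<close>, the edges being
  two-element subsets of \<open>V\<close>.\<close>

definition simple_graph :: "'a set \<Rightarrow> 'a set set \<Rightarrow> bool" where
  "simple_graph V E \<longleftrightarrow> finite V \<and> (\<forall>e\<in>E. e \<subseteq> V \<and> card e = 2)"

definition degree :: "'a set set \<Rightarrow> 'a \<Rightarrow> nat" where
  "degree E v = card {u. {v, u} \<in> E}"

definition min_degree :: "'a set \<Rightarrow> 'a set set \<Rightarrow> nat" where
  "min_degree V E = Min (degree E ` V)"

definition bipartite_hole ::
    "'a set \<Rightarrow> 'a set set \<Rightarrow> nat \<Rightarrow> nat \<Rightarrow> 'a set \<Rightarrow> 'a set \<Rightarrow> bool" where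
  "bipartite_hole V E s t S T \<longleftrightarrow>
     S \<subseteq> V \<and> T \<subseteq> V \<and> S \<inter> T = {} \<and> card S = s \<and> card T = t \<and>
     (\<forall>u\<in>S. \<forall>v\<in>T. {u, v} \<notin> E)"

definition bipartite_hole_number :: "'a set \<Rightarrow> 'a set set \<Rightarrow> nat" where
  "bipartite_hole_number V E =
     (LEAST r. \<exists>s t. s \<ge> 1 \<and> t \<ge> 1 \<and> r = s + t - 1 \<and> \<not> (\<exists>S T. bipartite_hole V E s t S T))"

text \<open>In the following definition the minimum ranges over an infinite set of natural numbers, hence
  \<open>INF\<close>, which on a nonempty set of naturals is the least element. As \<open>s \<le> a\<close>, the
  ceiling is positive, so neither \<open>nat\<close> nor the subtraction of \<open>1\<close> truncates. The value is
  only meaningful for \<open>a \<ge> 1\<close>, where the set of the maximum is nonempty.\<close>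

definition Phi :: "nat \<Rightarrow> nat \<Rightarrow> nat" where
  "Phi a D =
     (if D = 0 then a
      else Max ((\<lambda>s. INF x\<in>{x::nat. x \<ge> 2 * s + 2 * D}.
                   x + nat \<lceil>(real a + 1 - real s) * exp (4 * real s * real D / real x)\<rceil> - 1)
                ` {1..(a + 1) div 2}))"

text \<open>A Hamilton cycle is represented by a cyclic enumeration of the vertices; its starting point
  and direction do not affect \<open>cycle_edges\<close>.\<close>

definition cycle_edges :: "'a list \<Rightarrow> 'a set set" where
  "cycle_edges c = {{c ! i, c ! (Suc i mod length c)} | i. i < length c}"

definition hamilton_cycle :: "'a set \<Rightarrow> 'a set set \<Rightarrow> 'a list \<Rightarrow> bool" where
  "hamilton_cycle V E c \<longleftrightarrow>
     length c \<ge> 3 \<and> distinct c \<and> set c = V \<and> cycle_edges c \<subseteq> E"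

end

theory Submission
  imports Defs
begin

text \<open>
  Hamilton cycles are removed one at a time. After \<open>m\<close> of them are gone, the deleted edges form a
  graph \<open>H\<close> of maximum degree at most \<open>2 * m\<close>, so the minimum degree of \<open>E - H\<close> is still at least
  \<open>Phi a (2 * m)\<close>. Two facts then give one more Hamilton cycle in \<open>E - H\<close>.

  The first is the theorem of McDiarmid and Yolov (\<open>hamiltonian_if_min_degree_ge_hole\<close>): a graph on at
  least three vertices without an \<open>(s, t)\<close>-bipartite hole and with all degrees at least \<open>s + t - 1\<close>
  is Hamiltonian. In a longest path \<open>v\<^sub>0, \<dots>, v\<^sub>l\<close> all neighbours of both ends lie on the path.
  If its vertex set carried no cycle, every edge whose presence would close the path by a rotation
  would be absent. There are two families of such absent edges. One joins predecessors of neighbours of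
  \<open>v\<^sub>0\<close> to later successors of neighbours of \<open>v\<^sub>l\<close>; the other joins successors of neighbours of \<open>v\<^sub>l\<close>
  to successors of later neighbours of \<open>v\<^sub>0\<close>. Cutting the path at the \<open>s\<close>-th predecessor of a neighbour
  of \<open>v\<^sub>0\<close> and counting, one of the families contains an \<open>(s, t)\<close>-hole. Hence the vertices of a longest
  path carry a cycle, and this cycle is spanning: otherwise either an edge leaves it and gives a longer
  path, or no edge leaves it and its vertex set and the complement contain a hole between them.

  The second (\<open>no_hole_after_deletion\<close>) says that deleting a graph \<open>H\<close> of maximum degree \<open>D\<close> creates no
  \<open>(x, y)\<close>-hole, if \<open>E\<close> has no \<open>(s, t)\<close>-hole, \<open>x \<ge> 2 * s + 2 * D\<close> and
  \<open>y \<ge> t * exp (4 * s * D / x)\<close>. All edges of \<open>E\<close> across an \<open>(x, y)\<close>-hole of \<open>E - H\<close> belong to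
  \<open>H\<close>, and \<open>s\<close> vertices chosen greedily on the side of size \<open>x\<close> leave at least \<open>t\<close> vertices of the
  other side without an \<open>H\<close>-neighbour among them, which is an \<open>(s, t)\<close>-hole of \<open>E\<close>. The function \<open>Phi\<close>
  takes the best \<open>x\<close> for the worst pair with \<open>s + t - 1 = a\<close>.
\<close>

section \<open>Closing a path by rotations\<close>

definition graph_path :: "'a set \<Rightarrow> 'a set set \<Rightarrow> 'a list \<Rightarrow> bool" where
  "graph_path V E xs \<longleftrightarrow>
     xs \<noteq> [] \<and> distinct xs \<and> set xs \<subseteq> V \<and> successively (\<lambda>u v. {u, v} \<in> E) xs"

text \<open>A single edge, traversed back and forth, counts as closed. This lets a longest path on two
  vertices be treated like the others.\<close>

definition closed_path :: "'a set \<Rightarrow> 'a set set \<Rightarrow> 'a list \<Rightarrow> bool" where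
  "closed_path V E xs \<longleftrightarrow> graph_path V E xs \<and> {last xs, hd xs} \<in> E"

lemma successively_adjacent_rev:
  "successively (\<lambda>u v. {u, v} \<in> E) (rev xs) \<longleftrightarrow> successively (\<lambda>u v. {u, v} \<in> E) xs"
  by (simp add: insert_commute)

lemma closed_path_rotate_blocks:
  assumes "closed_path V E (ps @ qs)"
  shows "closed_path V E (qs @ ps)"
  using assms
  by (cases "ps = []"; cases "qs = []")
    (auto simp: closed_path_def graph_path_def successively_append_iff)

text \<open>The classical crossing pair: the first vertex of \<open>P @ Q\<close> sees the start of \<open>Q\<close> and the last one
  sees the end of \<open>P\<close>.\<close>

lemma close_crossing:
  assumes "graph_path V E (P @ Q)" "P \<noteq> []" "Q \<noteq> []"
    and "{hd P, hd Q} \<in> E" "{last Q, last P} \<in> E"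
  shows "closed_path V E (rev P @ Q)"
  using assms
  by (auto simp: closed_path_def graph_path_def successively_append_iff successively_adjacent_rev
      hd_rev last_rev simp del: successively_rev)

text \<open>Rotating at both ends makes \<open>last P\<close> and \<open>hd R\<close> the new ends, so an edge between them closes
  the path.\<close>

lemma close_both_ends_rotated:
  assumes "graph_path V E (P @ Q @ R)" "P \<noteq> []" "Q \<noteq> []" "R \<noteq> []"
    and "{hd P, hd Q} \<in> E" "{last R, last Q} \<in> E" "{last P, hd R} \<in> E"
  shows "closed_path V E (rev P @ Q @ rev R)"
  using assms
  by (auto simp: closed_path_def graph_path_def successively_append_iff successively_adjacent_rev
      hd_rev last_rev insert_commute simp del: successively_rev)

text \<open>Here the chords of the two ends overlap. Both are used together with the edge from \<open>hd Q\<close> to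
  \<open>hd R\<close>, while the two path edges at the block boundaries are dropped.\<close>

lemma close_overlapping:
  assumes "graph_path V E (P @ Q @ R)" "P \<noteq> []" "Q \<noteq> []" "R \<noteq> []"
    and "{last R, last P} \<in> E" "{hd P, last Q} \<in> E" "{hd Q, hd R} \<in> E"
  shows "closed_path V E (P @ rev R @ Q)"
  using assms
  by (auto simp: closed_path_def graph_path_def successively_append_iff successively_adjacent_rev
      hd_rev last_rev insert_commute simp del: successively_rev)

text \<open>Translates between positions on a path, which are convenient for counting, and the block
  decompositions of the closing lemmas.\<close>

lemma three_blocks:
  assumes "0 < a" "a \<le> b" "b < length xs"
  obtains P Q R where "xs = P @ Q @ R" "P \<noteq> []" "R \<noteq> []" "Q = [] \<longleftrightarrow> a = b"
    "hd P = xs ! 0" "last P = xs ! (a - 1)" "hd R = xs ! b" "last R = xs ! (length xs - 1)"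
    "Q \<noteq> [] \<Longrightarrow> hd Q = xs ! a" "Q \<noteq> [] \<Longrightarrow> last Q = xs ! (b - 1)"
proof
  let ?P = "take a xs" and ?Q = "take (b - a) (drop a xs)" and ?R = "drop b xs"
  have "drop (b - a) (drop a xs) = drop b xs" using assms by simp
  then show "xs = ?P @ ?Q @ ?R" by (metis append_take_drop_id)
  show "?P \<noteq> []" "?R \<noteq> []" "?Q = [] \<longleftrightarrow> a = b" using assms by auto
  show "hd ?P = xs ! 0" "last ?P = xs ! (a - 1)" "hd ?R = xs ! b" "last ?R = xs ! (length xs - 1)"
    using assms \<open>?P \<noteq> []\<close>
    by (auto simp: hd_conv_nth[of xs] hd_drop_conv_nth last_conv_nth min_def)
  show "hd ?Q = xs ! a" if "?Q \<noteq> []" using assms that by (auto simp: hd_conv_nth)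
  show "last ?Q = xs ! (b - 1)" if "?Q \<noteq> []"
    using assms that by (auto simp: last_conv_nth min_def)
qed

section \<open>Degrees and bipartite holes force a Hamilton cycle\<close>

lemma bipartite_hole_from_larger:
  assumes "finite V" "S \<subseteq> V" "T \<subseteq> V" "S \<inter> T = {}" "s \<le> card S" "t \<le> card T"
    and "\<And>u v. u \<in> S \<Longrightarrow> v \<in> T \<Longrightarrow> {u, v} \<notin> E"
  shows "\<exists>S T. bipartite_hole V E s t S T"
proof -
  obtain S' where "S' \<subseteq> S" "card S' = s" using assms by (meson obtain_subset_with_card_n)
  moreover obtain T' where "T' \<subseteq> T" "card T' = t" using assms by (meson obtain_subset_with_card_n)
  ultimately have "bipartite_hole V E s t S' T'"
    using assms unfolding bipartite_hole_def by blast
  then show ?thesis by blast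
qed

lemma bipartite_hole_along_path:
  assumes "finite V" "distinct xs" "set xs \<subseteq> V"
    and "I \<subseteq> {..<length xs}" "J \<subseteq> {..<length xs}" "s \<le> card I" "t \<le> card J"
    and sep: "\<And>i j. i \<in> I \<Longrightarrow> j \<in> J \<Longrightarrow> i < j \<and> {xs ! i, xs ! j} \<notin> E"
  shows "\<exists>S T. bipartite_hole V E s t S T"
proof (rule bipartite_hole_from_larger[where S = "(!) xs ` I" and T = "(!) xs ` J"])
  have inj: "inj_on ((!) xs) {..<length xs}"
    using assms(2) by (simp add: inj_on_def nth_eq_iff_index_eq)
  show "s \<le> card ((!) xs ` I)" "t \<le> card ((!) xs ` J)"
    using assms inj by (auto simp: card_image inj_on_subset)
  show "(!) xs ` I \<subseteq> V" "(!) xs ` J \<subseteq> V" using assms by (auto dest!: nth_mem)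
  show "(!) xs ` I \<inter> (!) xs ` J = {}"
    using inj assms(4,5) sep by (fastforce simp: inj_on_def)
qed (use assms in auto)

text \<open>The counting core of the McDiarmid-Yolov theorem. The sets \<open>A\<close> and \<open>B\<close> of the proof hold the
  positions just before the neighbours of the first vertex and just after those of the last vertex. If no
  rotation closes the path, then the vertices at \<open>A\<close> are not adjacent to those at later positions of
  \<open>B\<close>, and the vertex at a position \<open>j\<close> in \<open>B\<close> is not adjacent to the one at \<open>i + 2\<close> for any
  \<open>i \<ge> j\<close> in \<open>A\<close>. A cut position \<open>p\<close> with \<open>s\<close> elements of \<open>A\<close> up to \<open>p\<close> and \<open>t\<close> from \<open>p\<close> on exists because
  \<open>A\<close> has at least \<open>s + t - 1\<close> elements; depending on where \<open>B\<close> lies, one family or the other is a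
  hole.\<close>

lemma close_path_of_maximal_ends:
  assumes graph: "simple_graph V E"
    and path: "graph_path V E xs"
    and ends: "\<And>u. {hd xs, u} \<in> E \<Longrightarrow> u \<in> set xs" "\<And>u. {last xs, u} \<in> E \<Longrightarrow> u \<in> set xs"
    and deg: "s + t - 1 \<le> degree E (hd xs)" "s + t - 1 \<le> degree E (last xs)"
    and st: "1 \<le> s" "1 \<le> t"
    and nohole: "\<nexists>S T. bipartite_hole V E s t S T"
  shows "\<exists>ys. closed_path V E ys \<and> set ys = set xs"
proof (rule ccontr)
  assume no_closing: "\<not> ?thesis"
  define n where "n = length xs"
  have xs: "xs \<noteq> []" "distinct xs" "set xs \<subseteq> V" using path by (auto simp: graph_path_def)
  have n0: "n > 0" using xs by (simp add: n_def)
  have ht: "hd xs = xs ! 0" "last xs = xs ! (n - 1)"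
    using xs by (auto simp: hd_conv_nth last_conv_nth n_def)
  have finV: "finite V" and loop: "\<And>v. {v, v} \<notin> E"
    using graph by (auto simp: simple_graph_def)
  define A where "A = {i. Suc i < n \<and> {xs ! 0, xs ! Suc i} \<in> E}"
  define B where "B = {j. 0 < j \<and> j < n \<and> {xs ! (n - 1), xs ! (j - 1)} \<in> E}"
  have finA: "finite A" by (rule finite_subset[of _ "{..<n}"]) (auto simp: A_def)
  have finB: "finite B" by (rule finite_subset[of _ "{..<n}"]) (auto simp: B_def)
  have cardA: "s + t - 1 \<le> card A"
  proof -
    have "{u. {hd xs, u} \<in> E} \<subseteq> (\<lambda>i. xs ! Suc i) ` A"
    proof
      fix u assume u: "u \<in> {u. {hd xs, u} \<in> E}"
      then obtain m where m: "m < n" "u = xs ! m" using ends(1) by (auto simp: in_set_conv_nth n_def)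
      with u loop have "m \<noteq> 0" by (metis ht(1) mem_Collect_eq)
      then obtain i where "m = Suc i" by (cases m) auto
      then show "u \<in> (\<lambda>i. xs ! Suc i) ` A" using u m ht by (auto simp: A_def)
    qed
    then show ?thesis using deg(1) finA unfolding degree_def
      by (meson card_image_le card_mono finite_imageI le_trans)
  qed
  have cardB: "s + t - 1 \<le> card B"
  proof -
    have "{u. {last xs, u} \<in> E} \<subseteq> (\<lambda>j. xs ! (j - 1)) ` B"
    proof
      fix u assume u: "u \<in> {u. {last xs, u} \<in> E}"
      then obtain m where m: "m < n" "u = xs ! m" using ends(2) by (auto simp: in_set_conv_nth n_def)
      with u loop have "m \<noteq> n - 1" by (metis ht(2) mem_Collect_eq)
      then have "Suc m \<in> B" using u m ht by (auto simp: B_def)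
      then show "u \<in> (\<lambda>j. xs ! (j - 1)) ` B" using m by (intro image_eqI[of _ _ "Suc m"]) auto
    qed
    then show ?thesis using deg(2) finB unfolding degree_def
      by (meson card_image_le card_mono finite_imageI le_trans)
  qed
  have forward: "{xs ! i, xs ! j} \<notin> E" if i: "i \<in> A" and j: "j \<in> B" and "i < j" for i j
  proof
    assume e: "{xs ! i, xs ! j} \<in> E"
    have "0 < Suc i" "Suc i \<le> j" "j < length xs" using that by (auto simp: B_def n_def)
    then obtain P Q R where bl: "xs = P @ Q @ R" "P \<noteq> []" "R \<noteq> []" "Q = [] \<longleftrightarrow> Suc i = j"
      "hd P = xs ! 0" "last P = xs ! (Suc i - 1)" "hd R = xs ! j" "last R = xs ! (length xs - 1)"
      "Q \<noteq> [] \<Longrightarrow> hd Q = xs ! Suc i" "Q \<noteq> [] \<Longrightarrow> last Q = xs ! (j - 1)"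
      by (rule three_blocks) blast
    have adj: "{xs ! 0, xs ! Suc i} \<in> E" "{xs ! (n - 1), xs ! (j - 1)} \<in> E"
      using i j by (auto simp: A_def B_def)
    show False
    proof (cases "Q = []")
      case True
      then have "closed_path V E (rev P @ R)"
        using path bl adj by (intro close_crossing) (auto simp: n_def)
      then show False using no_closing bl True by (metis append_Nil set_append set_rev)
    next
      case False
      then have "closed_path V E (rev P @ Q @ rev R)"
        using path bl adj e by (intro close_both_ends_rotated) (auto simp: n_def)
      then show False using no_closing bl by (metis set_append set_rev)
    qed
  qed
  have backward: "i + 2 < n \<and> {xs ! j, xs ! (i + 2)} \<notin> E"
    if i: "i \<in> A" and j: "j \<in> B" and "j \<le> i" for i j
  proof
    have adj: "{xs ! 0, xs ! Suc i} \<in> E" "{xs ! (n - 1), xs ! (j - 1)} \<in> E"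
      using i j by (auto simp: A_def B_def)
    show less: "i + 2 < n"
    proof (rule ccontr)
      assume "\<not> i + 2 < n"
      then have "Suc i = n - 1" using i by (auto simp: A_def)
      then have "closed_path V E xs"
        using adj path ht by (simp add: closed_path_def insert_commute)
      then show False using no_closing by blast
    qed
    show "{xs ! j, xs ! (i + 2)} \<notin> E"
    proof
      assume e: "{xs ! j, xs ! (i + 2)} \<in> E"
      have "0 < j" "j \<le> i + 2" "i + 2 < length xs" using that less by (auto simp: B_def n_def)
      then obtain P Q R where bl: "xs = P @ Q @ R" "P \<noteq> []" "R \<noteq> []" "Q = [] \<longleftrightarrow> j = i + 2"
        "hd P = xs ! 0" "last P = xs ! (j - 1)" "hd R = xs ! (i + 2)"
        "last R = xs ! (length xs - 1)"
        "Q \<noteq> [] \<Longrightarrow> hd Q = xs ! j" "Q \<noteq> [] \<Longrightarrow> last Q = xs ! (i + 2 - 1)"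
        by (rule three_blocks) blast
      have "Q \<noteq> []" using bl(4) \<open>j \<le> i\<close> by simp
      then have "closed_path V E (P @ rev R @ Q)"
        using path bl adj e by (intro close_overlapping) (auto simp: n_def)
      moreover have "set (P @ rev R @ Q) = set xs" using bl(1) by auto
      ultimately show False using no_closing by blast
    qed
  qed
  \<comment> \<open>The position of the \<open>s\<close>-th element of \<open>A\<close>; it is counted on both sides of the cut, which is
    why \<open>s + t - 1\<close> elements suffice.\<close>
  define p where "p = (LEAST p. s \<le> card (A \<inter> {..p}))"
  have "A \<inter> {..n} = A" by (auto simp: A_def)
  then have "s \<le> card (A \<inter> {..n})" using cardA st by simp
  then have p: "s \<le> card (A \<inter> {..p})" unfolding p_def by (rule LeastI)
  have "card (A \<inter> {..<p}) < s"
  proof (cases p)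
    case 0
    then show ?thesis using st by simp
  next
    case (Suc q)
    then have "\<not> s \<le> card (A \<inter> {..q})" unfolding p_def by (metis lessI not_less_Least)
    then show ?thesis using Suc by (simp add: lessThan_Suc_atMost)
  qed
  moreover have "card A = card (A \<inter> {..<p}) + card (A \<inter> {p..})"
    using finA by (subst card_Un_disjoint[symmetric]) (auto intro: arg_cong[of _ _ card])
  ultimately have late: "t \<le> card (A \<inter> {p..})" using cardA by linarith
  have "card B = card (B \<inter> {..p}) + card (B \<inter> {p<..})"
    using finB by (subst card_Un_disjoint[symmetric]) (auto intro: arg_cong[of _ _ card])
  then consider "t \<le> card (B \<inter> {p<..})" | "s \<le> card (B \<inter> {..p})" using cardB by linarith
  then show False
  proof cases
    case 1
    have "i < j \<and> {xs ! i, xs ! j} \<notin> E" if "i \<in> A \<inter> {..p}" "j \<in> B \<inter> {p<..}" for i j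
      using that forward[of i j] by simp
    then have "\<exists>S T. bipartite_hole V E s t S T"
      by (intro bipartite_hole_along_path[OF finV xs(2,3) _ _ p 1]) (auto simp: A_def B_def n_def)
    then show False using nohole by simp
  next
    case 2
    then have "B \<inter> {..p} \<noteq> {}" using st(1) by (intro notI) simp
    then obtain j0 where j0: "j0 \<in> B" "j0 \<le> p" by auto
    \<comment> \<open>If \<open>v\<^sub>0\<close> is adjacent to \<open>v\<^sub>m\<close>, then \<open>i = m - 1\<close> is in \<open>A\<close>, so the shift by two gives the
      position after the neighbour.\<close>
    let ?J = "(\<lambda>i. i + 2) ` (A \<inter> {p..})"
    have tJ: "t \<le> card ?J" using late by (subst card_image) (auto simp: inj_on_def)
    have J: "?J \<subseteq> {..<length xs}"
      using backward[OF _ j0(1)] j0(2) by (fastforce simp: n_def)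
    have sep: "i < j \<and> {xs ! i, xs ! j} \<notin> E" if "i \<in> B \<inter> {..p}" "j \<in> ?J" for i j
      using that backward by auto
    have "B \<inter> {..p} \<subseteq> {..<length xs}" by (auto simp: B_def n_def)
    then have "\<exists>S T. bipartite_hole V E s t S T"
      using bipartite_hole_along_path[OF finV xs(2,3) _ J 2 tJ sep] by blast
    then show False using nohole by simp
  qed
qed

lemma closed_path_imp_hamilton_cycle:
  assumes "closed_path V E xs" "set xs = V" "3 \<le> card V"
  shows "hamilton_cycle V E xs"
proof -
  have xs: "xs \<noteq> []" "distinct xs" "successively (\<lambda>u v. {u, v} \<in> E) xs" "{last xs, hd xs} \<in> E"
    using assms(1) by (auto simp: closed_path_def graph_path_def)
  have "{xs ! i, xs ! (Suc i mod length xs)} \<in> E" if "i < length xs" for i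
  proof (cases "Suc i < length xs")
    case True
    then show ?thesis using successively_nth[OF xs(3), of i] by simp
  next
    case False
    then have "i = length xs - 1" "Suc i = length xs" using that by auto
    then show ?thesis using xs by (simp add: hd_conv_nth last_conv_nth)
  qed
  moreover have "length xs = card V" using xs(2) assms(2) distinct_card by metis
  ultimately show ?thesis using assms(2,3) xs(2)
    by (auto simp: hamilton_cycle_def cycle_edges_def)
qed

text \<open>The theorem of McDiarmid and Yolov. A longest path can be replaced by a closed one on the same
  vertices. A closed path may be opened anywhere, so by maximality no edge leaves its vertex set; if this
  set \<open>W\<close> were not everything, then \<open>W\<close> and its complement would each contain a vertex with all its
  neighbours, hence at least \<open>s + t\<close> vertices, and a hole would lie between them.\<close>

lemma hamiltonian_if_min_degree_ge_hole:
  assumes graph: "simple_graph V E" and V3: "3 \<le> card V"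
    and st: "1 \<le> s" "1 \<le> t"
    and nohole: "\<nexists>S T. bipartite_hole V E s t S T"
    and deg: "\<And>v. v \<in> V \<Longrightarrow> s + t - 1 \<le> degree E v"
  shows "\<exists>c. hamilton_cycle V E c"
proof -
  have finV: "finite V" and inV: "\<And>u v. {u, v} \<in> E \<Longrightarrow> u \<in> V \<and> v \<in> V" and loop: "\<And>v. {v, v} \<notin> E"
    using graph by (auto simp: simple_graph_def)
  have bound: "length xs \<le> card V" if "graph_path V E xs" for xs
    using that finV by (metis card_mono distinct_card graph_path_def)
  obtain v where "v \<in> V" using V3 by fastforce
  then have "graph_path V E [v]" by (simp add: graph_path_def)
  then obtain xs where path: "graph_path V E xs"
    and longest: "\<And>ys. graph_path V E ys \<Longrightarrow> length ys \<le> length xs"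
    using ex_has_greatest_nat[of "graph_path V E" "[v]" length "Suc (card V)"] bound
    by (auto simp: less_Suc_eq_le)
  have no_extension: "u \<in> set ys" if ys: "graph_path V E ys" "length ys = length xs"
    and u: "{hd ys, u} \<in> E" for ys u
  proof (rule ccontr)
    assume "u \<notin> set ys"
    then have "graph_path V E (u # ys)"
      using ys u inV by (cases ys) (auto simp: graph_path_def insert_commute)
    then show False using longest ys by fastforce
  qed
  have rev: "graph_path V E (rev xs)"
    using path by (simp add: graph_path_def successively_adjacent_rev del: successively_rev)
  have xs: "xs \<noteq> []" "set xs \<subseteq> V" using path by (auto simp: graph_path_def)
  then have ends_in_V: "hd xs \<in> V" "last xs \<in> V" by auto
  have "\<exists>ys. closed_path V E ys \<and> set ys = set xs"
  proof (rule close_path_of_maximal_ends[OF graph path _ _ _ _ st nohole])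
    show "u \<in> set xs" if "{hd xs, u} \<in> E" for u using no_extension path that by blast
    show "u \<in> set xs" if "{last xs, u} \<in> E" for u
      using no_extension[OF rev] that by (simp add: hd_rev)
    show "s + t - 1 \<le> degree E (hd xs)" "s + t - 1 \<le> degree E (last xs)"
      using deg ends_in_V by blast+
  qed
  then obtain ys where ys: "closed_path V E ys" "set ys = set xs" by blast
  have len: "length ys = length xs"
    using ys path by (metis closed_path_def distinct_card graph_path_def)
  have isolated: "u \<in> set ys" if w: "w \<in> set ys" and u: "{w, u} \<in> E" for w u
  proof -
    obtain ps qs where "ys = ps @ w # qs" using w by (meson split_list)
    then have "graph_path V E ((w # qs) @ ps)" "set ((w # qs) @ ps) = set ys"
      "length ((w # qs) @ ps) = length xs"
      using ys closed_path_rotate_blocks[of V E ps "w # qs"] len by (auto simp: closed_path_def)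
    then show ?thesis using no_extension[of "(w # qs) @ ps" u] u by auto
  qed
  have size: "s + t \<le> card W" if W: "W \<subseteq> V" "w \<in> W" "\<And>u. {w, u} \<in> E \<Longrightarrow> u \<in> W" for W w
  proof -
    have finW: "finite W" using W finV finite_subset by blast
    have "insert w {u. {w, u} \<in> E} \<subseteq> W" using W by auto
    moreover have "card (insert w {u. {w, u} \<in> E}) = Suc (degree E w)"
      unfolding degree_def using loop finite_subset[OF calculation finW] by (subst card_insert_disjoint) auto
    ultimately have "Suc (degree E w) \<le> card W" by (metis card_mono finW)
    then show ?thesis using deg W by fastforce
  qed
  have "set ys = V"
  proof (rule ccontr)
    assume ne: "set ys \<noteq> V"
    have "hd xs \<in> set ys" using ys xs by simp
    then have "s + t \<le> card (set ys)" using isolated ys(2) xs(2) by (intro size[of _ "hd xs"]) auto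
    moreover obtain z where z: "z \<in> V - set ys" using ne ys xs by auto
    have "s + t \<le> card (V - set ys)"
    proof (rule size)
      show "z \<in> V - set ys" by (rule z)
      show "u \<in> V - set ys" if "{z, u} \<in> E" for u
        using that isolated[of u z] inV z by (auto simp: insert_commute)
    qed auto
    ultimately have "\<exists>S T. bipartite_hole V E s t S T"
      using isolated ys xs finV
      by (intro bipartite_hole_from_larger[where S = "set ys" and T = "V - set ys"]) auto
    then show False using nohole by simp
  qed
  then show ?thesis using closed_path_imp_hamilton_cycle ys V3 by blast
qed

section \<open>Deleting edges of bounded degree\<close>

lemma exp_le_one_minus:
  fixes u :: real
  assumes "0 \<le> u" "u \<le> 1 / 2"
  shows "exp (- 2 * u) \<le> 1 - u"
proof -
  have "u * u \<le> u * (1 / 2)" using assms by (intro mult_left_mono) auto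
  then have "- 2 * u \<le> - u - 2 * u\<^sup>2" by (simp add: power2_eq_square)
  also have "\<dots> \<le> ln (1 - u)" using assms by (rule ln_one_minus_pos_lower_bound)
  finally have "exp (- 2 * u) \<le> exp (ln (1 - u))" by simp
  then show ?thesis using assms by simp
qed

text \<open>A greedy form of choosing a random \<open>s\<close>-subset of \<open>X\<close>. When \<open>j\<close> vertices are chosen and \<open>Z\<close> is
  the set of vertices of \<open>Y\<close> still without a chosen neighbour, an average remaining vertex of \<open>X\<close> has at
  most \<open>D / (card X - j)\<close> times \<open>card Z\<close> neighbours in \<open>Z\<close>. Since \<open>j < s\<close> and
  \<open>card X \<ge> 2 * s + 2 * D\<close>, this fraction is at most \<open>1 / 2\<close> and at most \<open>2 * D / card X\<close>, so each step
  keeps at least the fraction \<open>exp (- 4 * D / card X)\<close> of \<open>Z\<close>.\<close>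

lemma greedy_nonneighbours:
  fixes R :: "'a \<Rightarrow> 'b \<Rightarrow> bool"
  assumes fin: "finite X" "finite Y"
    and deg: "\<And>y. y \<in> Y \<Longrightarrow> card {v \<in> X. R v y} \<le> D"
    and size: "2 * s + 2 * D \<le> card X" and "j \<le> s"
  shows "\<exists>S\<subseteq>X. card S = j \<and>
    real (card Y) * exp (- (4 * real D / real (card X)) * real j)
      \<le> real (card {y \<in> Y. \<forall>v\<in>S. \<not> R v y})"
  using \<open>j \<le> s\<close>
proof (induction j)
  case 0
  show ?case by (intro exI[of _ "{}"]) simp
next
  case (Suc j)
  let ?x = "real (card X)"
  obtain S where S: "S \<subseteq> X" "card S = j"
    and IH: "real (card Y) * exp (- (4 * real D / ?x) * real j)
      \<le> real (card {y \<in> Y. \<forall>v\<in>S. \<not> R v y})"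
    using Suc by auto
  define Z where "Z = {y \<in> Y. \<forall>v\<in>S. \<not> R v y}"
  define u where "u = real D / real (card X - j)"
  have finS: "finite S" using S fin finite_subset by blast
  have finZ: "finite Z" using fin by (simp add: Z_def)
  have cardXS: "card (X - S) = card X - j" using S finS by (simp add: card_Diff_subset)
  have xj: "0 < card X - j" "real (card X - j) = ?x - real j" using size Suc.prems by auto
  have "2 * real D \<le> real (card X - j)" using size Suc.prems by linarith
  then have u: "0 \<le> u" "u \<le> 1 / 2" using xj by (auto simp: u_def field_simps)
  have "real D * ?x \<le> real D * (2 * real (card X - j))"
    using size Suc.prems by (intro mult_left_mono) linarith+
  then have u2: "2 * u \<le> 4 * real D / ?x"
    using xj by (simp add: u_def field_simps)
  have "\<exists>v\<in>X - S. real (card {y \<in> Z. R v y}) \<le> u * real (card Z)"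
  proof (rule ccontr)
    assume "\<not> ?thesis"
    then have "(\<Sum>v\<in>X - S. u * real (card Z)) < (\<Sum>v\<in>X - S. real (card {y \<in> Z. R v y}))"
    proof (intro sum_strict_mono)
      show "X - S \<noteq> {}" using xj(1) cardXS by (metis card.empty less_irrefl)
    qed (use fin in \<open>auto simp: not_le\<close>)
    also have "\<dots> = real (\<Sum>v\<in>X - S. \<Sum>y\<in>Z. if R v y then 1 else 0)"
      using finZ by (simp flip: sum.inter_filter)
    also have "\<dots> = real (\<Sum>y\<in>Z. \<Sum>v\<in>X - S. if R v y then 1 else 0)"
      by (subst sum.swap) simp
    also have "\<dots> = real (\<Sum>y\<in>Z. card {v \<in> X - S. R v y})"
      using fin by (simp flip: sum.inter_filter)
    also have "\<dots> \<le> real (\<Sum>y\<in>Z. D)"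
    proof (intro of_nat_mono sum_mono)
      fix y assume "y \<in> Z"
      then have "card {v \<in> X. R v y} \<le> D" using deg by (auto simp: Z_def)
      moreover have "card {v \<in> X - S. R v y} \<le> card {v \<in> X. R v y}"
        using fin by (intro card_mono) auto
      ultimately show "card {v \<in> X - S. R v y} \<le> D" by linarith
    qed
    also have "\<dots> = (\<Sum>v\<in>X - S. u * real (card Z))"
      using xj cardXS by (simp add: u_def)
    finally show False by simp
  qed
  then obtain v where v: "v \<in> X - S" "real (card {y \<in> Z. R v y}) \<le> u * real (card Z)" by blast
  have "{y \<in> Y. \<forall>w\<in>insert v S. \<not> R w y} = Z - {y \<in> Z. R v y}" by (auto simp: Z_def)
  then have "card {y \<in> Y. \<forall>w\<in>insert v S. \<not> R w y} = card Z - card {y \<in> Z. R v y}"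
    using finZ by (simp add: card_Diff_subset)
  then have new: "(1 - u) * real (card Z) \<le> real (card {y \<in> Y. \<forall>w\<in>insert v S. \<not> R w y})"
    using v(2) by (simp add: algebra_simps)
  have "exp (- (4 * real D / ?x)) \<le> exp (- 2 * u)" using u2 by simp
  also have "\<dots> \<le> 1 - u" using u by (rule exp_le_one_minus)
  finally have step: "exp (- (4 * real D / ?x)) \<le> 1 - u" .
  have "real (card Y) * exp (- (4 * real D / ?x) * real (Suc j))
      = exp (- (4 * real D / ?x)) * (real (card Y) * exp (- (4 * real D / ?x) * real j))"
    by (simp add: algebra_simps add_divide_distrib flip: exp_add)
  also have "\<dots> \<le> (1 - u) * real (card Z)"
    using step IH u by (intro mult_mono) (auto simp: Z_def)
  finally have "real (card Y) * exp (- (4 * real D / ?x) * real (Suc j))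
      \<le> real (card {y \<in> Y. \<forall>w\<in>insert v S. \<not> R w y})" using new by linarith
  moreover have "insert v S \<subseteq> X" "card (insert v S) = Suc j" using v S finS by auto
  ultimately show ?case by blast
qed

text \<open>In a hole of \<open>E - H\<close> all edges of \<open>E\<close> between the two sides belong to \<open>H\<close>. The greedy choice
  therefore finds a hole of \<open>E\<close> inside it, and the factor \<open>exp (4 * s * D / x)\<close> in the size of the
  second side pays for the loss in its \<open>s\<close> steps.\<close>

lemma no_hole_after_deletion:
  assumes finV: "finite V"
    and nohole: "\<nexists>S T. bipartite_hole V E s t S T"
    and degH: "\<And>v. v \<in> V \<Longrightarrow> finite {u. {v, u} \<in> H} \<and> degree H v \<le> D"
    and x: "2 * s + 2 * D \<le> x"
    and y: "real t * exp (4 * real s * real D / real x) \<le> real y"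
  shows "\<nexists>S T. bipartite_hole V (E - H) x y S T"
proof
  assume "\<exists>S T. bipartite_hole V (E - H) x y S T"
  then obtain X Y where XY: "X \<subseteq> V" "Y \<subseteq> V" "X \<inter> Y = {}" "card X = x" "card Y = y"
    and cross: "\<And>u v. u \<in> X \<Longrightarrow> v \<in> Y \<Longrightarrow> {u, v} \<in> E \<Longrightarrow> {u, v} \<in> H"
    unfolding bipartite_hole_def by blast
  have fin: "finite X" "finite Y" using XY finV finite_subset by auto
  have deg: "card {u \<in> X. {u, v} \<in> H} \<le> D" if "v \<in> Y" for v
  proof -
    have "card {u \<in> X. {u, v} \<in> H} \<le> degree H v"
      unfolding degree_def using degH[of v] that XY
      by (intro card_mono) (auto simp: insert_commute)
    then show ?thesis using degH[of v] that XY by auto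
  qed
  obtain S where S: "S \<subseteq> X" "card S = s"
    and big: "real y * exp (- (4 * real D / real x) * real s)
      \<le> real (card {v \<in> Y. \<forall>u\<in>S. {u, v} \<notin> H})"
    using greedy_nonneighbours[where R = "\<lambda>u v. {u, v} \<in> H" and s = s and j = s, OF fin deg] x XY
    by auto
  have "real t = real t * exp (4 * real s * real D / real x) * exp (- (4 * real D / real x) * real s)"
    by (simp add: mult.assoc flip: exp_add)
  also have "\<dots> \<le> real y * exp (- (4 * real D / real x) * real s)"
    using y by (intro mult_right_mono) auto
  finally have "t \<le> card {v \<in> Y. \<forall>u\<in>S. {u, v} \<notin> H}" using big by linarith
  then have "\<exists>S T. bipartite_hole V E s t S T"
    using XY S cross finV
    by (intro bipartite_hole_from_larger[where S = S and T = "{v \<in> Y. \<forall>u\<in>S. {u, v} \<notin> H}"]) blast+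
  then show False using nohole by simp
qed

text \<open>Enlarging either side of an absent hole keeps it absent, and swapping the sides does too. So the
  pair may be taken with sum exactly \<open>a + 1\<close> and with the smaller side first, which is the range of \<open>s\<close>
  in \<open>Phi\<close>.\<close>

lemma bipartite_hole_number_le_cases:
  assumes "finite V" "bipartite_hole_number V E \<le> a"
  obtains s where "1 \<le> s" "s \<le> (a + 1) div 2" "\<nexists>S T. bipartite_hole V E s (a + 1 - s) S T"
proof -
  let ?P = "\<lambda>r. \<exists>s t. s \<ge> 1 \<and> t \<ge> 1 \<and> r = s + t - 1 \<and> \<not> (\<exists>S T. bipartite_hole V E s t S T)"
  \<comment> \<open>Some pair is hole-free, so that the least value in the definition is attained.\<close>
  have "\<not> (\<exists>S T. bipartite_hole V E (card V + 1) 1 S T)"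
    using card_mono[OF assms(1)] unfolding bipartite_hole_def by fastforce
  then have "?P (card V + 1)" by (intro exI[of _ "card V + 1"] exI[of _ 1]) simp
  then have "?P (bipartite_hole_number V E)" unfolding bipartite_hole_number_def by (rule LeastI)
  then obtain s t where st: "1 \<le> s" "1 \<le> t" "s + t - 1 \<le> a"
    and nohole: "\<nexists>S T. bipartite_hole V E s t S T" using assms(2) by auto
  have larger: "\<nexists>S T. bipartite_hole V E s' t' S T" if "s \<le> s'" "t \<le> t'" for s' t'
  proof
    assume "\<exists>S T. bipartite_hole V E s' t' S T"
    then obtain S T where "bipartite_hole V E s' t' S T" by blast
    then have "\<exists>S T. bipartite_hole V E s t S T"
      using that assms(1)
      by (intro bipartite_hole_from_larger[of V S T]) (auto simp: bipartite_hole_def)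
    then show False using nohole by simp
  qed
  show ?thesis
  proof (cases "s \<le> (a + 1) div 2")
    case True
    then show ?thesis using st by (intro that[of s] larger) auto
  next
    case False
    let ?s = "a + 1 - s"
    have "\<nexists>S T. bipartite_hole V E s ?s S T" using st by (intro larger) auto
    moreover have "bipartite_hole V E s ?s T S" if "bipartite_hole V E ?s s S T" for S T
      using that unfolding bipartite_hole_def by (metis Int_commute insert_commute)
    ultimately have "\<nexists>S T. bipartite_hole V E ?s s S T" by blast
    moreover have "a + 1 - ?s = s" "1 \<le> ?s" "?s \<le> (a + 1) div 2" using st False by auto
    ultimately show ?thesis by (intro that[of ?s]) auto
  qed
qed

text \<open>\<open>Phi a D\<close> bounds the bipartite-hole-number of \<open>E - H\<close>: the pair consists of the \<open>x\<close> that attains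
  the minimum for the given \<open>s\<close> and the ceiling in the definition of \<open>Phi\<close>. For \<open>D = 0\<close> the
  definition is \<open>a\<close>, and the pair \<open>s, a + 1 - s\<close> itself is used.\<close>

lemma hole_free_pair_of_Phi:
  assumes finV: "finite V" and hole: "bipartite_hole_number V E \<le> a"
    and degH: "\<And>v. v \<in> V \<Longrightarrow> finite {u. {v, u} \<in> H} \<and> degree H v \<le> D"
    and none: "D = 0 \<Longrightarrow> H = {}"
  obtains x y where "1 \<le> x" "1 \<le> y" "x + y - 1 \<le> Phi a D" "\<nexists>S T. bipartite_hole V (E - H) x y S T"
proof -
  obtain s where s: "1 \<le> s" "s \<le> (a + 1) div 2"
    and nohole: "\<nexists>S T. bipartite_hole V E s (a + 1 - s) S T"
    using bipartite_hole_number_le_cases[OF finV hole] by blast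
  show thesis
  proof (cases "D = 0")
    case True
    then show thesis using none s nohole by (intro that[of s "a + 1 - s"]) (auto simp: Phi_def)
  next
    case False
    define f where "f = (\<lambda>s x::nat.
      x + nat \<lceil>(real a + 1 - real s) * exp (4 * real s * real D / real x)\<rceil> - 1)"
    let ?F = "\<lambda>s. INF x\<in>{x::nat. x \<ge> 2 * s + 2 * D}. f s x"
    have "?F s \<in> f s ` {x. x \<ge> 2 * s + 2 * D}"
      by (rule Inf_nat_def1) auto
    then obtain x where x: "2 * s + 2 * D \<le> x" "?F s = f s x" by auto
    have "?F s \<le> Max (?F ` {1..(a + 1) div 2})" using s by (intro Max_ge) auto
    then have le: "f s x \<le> Phi a D" using False x by (simp add: Phi_def f_def)
    define y where "y = nat \<lceil>(real a + 1 - real s) * exp (4 * real s * real D / real x)\<rceil>"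
    have as: "real (a + 1 - s) = real a + 1 - real s" "0 < real a + 1 - real s"
      using s by auto
    have y: "real (a + 1 - s) * exp (4 * real s * real D / real x) \<le> real y"
      unfolding y_def as by (rule real_nat_ceiling_ge)
    have "0 < real (a + 1 - s) * exp (4 * real s * real D / real x)" using as by simp
    then have "0 < real y" using y by linarith
    then have "1 \<le> y" by simp
    moreover have "\<nexists>S T. bipartite_hole V (E - H) x y S T"
      by (rule no_hole_after_deletion[OF finV nohole degH x(1) y])
    moreover have "x + y - 1 \<le> Phi a D" using le by (simp add: f_def y_def)
    ultimately show thesis using x s by (intro that[of x y]) auto
  qed
qed

section \<open>Removing Hamilton cycles one at a time\<close>

lemma cycle_neighbours:
  assumes "distinct c"
  shows "finite {u. {v, u} \<in> cycle_edges c}" "degree (cycle_edges c) v \<le> 2"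
proof -
  let ?n = "length c"
  have "\<exists>w w'. {u. {v, u} \<in> cycle_edges c} \<subseteq> {w, w'}"
  proof (cases "v \<in> set c")
    case False
    have "{u. {v, u} \<in> cycle_edges c} = {}"
    proof -
      have "e \<subseteq> set c" if "e \<in> cycle_edges c" for e
        using that by (auto simp: cycle_edges_def intro!: nth_mem mod_less_divisor)
      then show ?thesis using False by blast
    qed
    then show ?thesis by blast
  next
    case True
    then obtain p where p: "p < ?n" "v = c ! p" by (auto simp: in_set_conv_nth)
    \<comment> \<open>The cyclic predecessor of position \<open>p\<close>.\<close>
    define q where "q = (if p = 0 then ?n - 1 else p - 1)"
    have "u \<in> {c ! (Suc p mod ?n), c ! q}" if "{v, u} \<in> cycle_edges c" for u
    proof -
      obtain i where i: "i < ?n" "{v, u} = {c ! i, c ! (Suc i mod ?n)}"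
        using \<open>{v, u} \<in> cycle_edges c\<close> by (auto simp: cycle_edges_def)
      have m: "Suc i mod ?n < ?n" using i by (intro mod_less_divisor) auto
      from i(2) consider "v = c ! i" "u = c ! (Suc i mod ?n)" | "v = c ! (Suc i mod ?n)" "u = c ! i"
        by (auto simp: doubleton_eq_iff)
      then show ?thesis
      proof cases
        case 1
        then have "i = p" using p i assms by (simp add: nth_eq_iff_index_eq)
        then show ?thesis using 1 by simp
      next
        case 2
        then have "Suc i mod ?n = p" using p m assms by (simp add: nth_eq_iff_index_eq)
        then have "i = q" using i(1) by (auto simp: q_def mod_Suc split: if_splits)
        then show ?thesis using 2 by simp
      qed
    qed
    then show ?thesis by blast
  qed
  then obtain w w' where sub: "{u. {v, u} \<in> cycle_edges c} \<subseteq> {w, w'}" by blast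
  then show "finite {u. {v, u} \<in> cycle_edges c}" by (rule finite_subset) simp
  have "degree (cycle_edges c) v \<le> card {w, w'}"
    unfolding degree_def using sub by (intro card_mono) auto
  also have "\<dots> \<le> 2" by (simp add: card_insert_if)
  finally show "degree (cycle_edges c) v \<le> 2" .
qed

lemma union_of_cycles_degree:
  fixes C :: "nat \<Rightarrow> 'a list"
  assumes "\<And>i. i < m \<Longrightarrow> distinct (C i)"
  shows "finite {u. {v, u} \<in> (\<Union>i<m. cycle_edges (C i))}"
    and "degree (\<Union>i<m. cycle_edges (C i)) v \<le> 2 * m"
proof -
  have eq: "{u. {v, u} \<in> (\<Union>i<m. cycle_edges (C i))} = (\<Union>i<m. {u. {v, u} \<in> cycle_edges (C i)})"
    by auto
  show "finite {u. {v, u} \<in> (\<Union>i<m. cycle_edges (C i))}"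
    unfolding eq by (intro finite_UN_I cycle_neighbours(1)) (auto intro: assms)
  have "card (\<Union>i<m. {u. {v, u} \<in> cycle_edges (C i)}) \<le> (\<Sum>i<m. card {u. {v, u} \<in> cycle_edges (C i)})"
    by (rule card_UN_le) simp
  also have "\<dots> \<le> (\<Sum>i<m. 2)"
    by (intro sum_mono cycle_neighbours(2)[unfolded degree_def]) (auto intro: assms)
  finally show "degree (\<Union>i<m. cycle_edges (C i)) v \<le> 2 * m"
    unfolding degree_def eq by simp
qed

theorem theorem1p5:
  fixes V :: "'a set" and E :: "'a set set" and k a :: nat
  assumes "simple_graph V E"
    and "card V \<ge> 3"
    and "k \<ge> 1"
    and "a \<ge> 1"
    and "a \<ge> bipartite_hole_number V E"
    and "min_degree V E \<ge> Max ((\<lambda>i. 2 * i + Phi a (2 * i)) ` {0..k - 1})"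
  shows "\<exists>C :: nat \<Rightarrow> 'a list.
           (\<forall>i<k. hamilton_cycle V E (C i)) \<and>
           (\<forall>i<k. \<forall>j<k. i \<noteq> j \<longrightarrow> cycle_edges (C i) \<inter> cycle_edges (C j) = {})"
proof -
  have finV: "finite V" using assms(1) by (simp add: simple_graph_def)
  have "\<exists>C. (\<forall>i<m. hamilton_cycle V E (C i)) \<and>
      (\<forall>i<m. \<forall>j<m. i \<noteq> j \<longrightarrow> cycle_edges (C i) \<inter> cycle_edges (C j) = {})"
    if "m \<le> k" for m
    using that
  proof (induction m)
    case 0
    show ?case by simp
  next
    case (Suc m)
    then obtain C where C: "\<forall>i<m. hamilton_cycle V E (C i)"
      and disj: "\<forall>i<m. \<forall>j<m. i \<noteq> j \<longrightarrow> cycle_edges (C i) \<inter> cycle_edges (C j) = {}"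
      using Suc_leD by blast
    define H where "H = (\<Union>i<m. cycle_edges (C i))"
    have dC: "distinct (C i)" if "i < m" for i using C that by (simp add: hamilton_cycle_def)
    have H: "finite {u. {v, u} \<in> H}" "degree H v \<le> 2 * m" for v
      using union_of_cycles_degree[of m C v] dC by (auto simp: H_def)
    obtain x y where xy: "1 \<le> x" "1 \<le> y" "x + y - 1 \<le> Phi a (2 * m)"
      and nohole: "\<nexists>S T. bipartite_hole V (E - H) x y S T"
      using hole_free_pair_of_Phi[OF finV assms(5), of H "2 * m"] H by (auto simp: H_def)
    have "\<exists>c. hamilton_cycle V (E - H) c"
    proof (rule hamiltonian_if_min_degree_ge_hole[OF _ assms(2) xy(1,2) nohole])
      show "simple_graph V (E - H)" using assms(1) by (auto simp: simple_graph_def)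
      fix v assume v: "v \<in> V"
      have "2 * m + Phi a (2 * m) \<le> Max ((\<lambda>i. 2 * i + Phi a (2 * i)) ` {0..k - 1})"
        using Suc.prems by (intro Max_ge) auto
      also have "\<dots> \<le> min_degree V E" by (rule assms(6))
      also have "\<dots> \<le> degree E v" unfolding min_degree_def using v finV by (intro Min_le) auto
      also have "\<dots> \<le> degree (E - H) v + degree H v"
      proof -
        have "{u. {v, u} \<in> E - H} \<subseteq> V" using assms(1) by (auto simp: simple_graph_def)
        then have "finite {u. {v, u} \<in> E - H}" using finV finite_subset by blast
        then have "degree E v \<le> card ({u. {v, u} \<in> E - H} \<union> {u. {v, u} \<in> H})"
          unfolding degree_def using H(1) by (intro card_mono) auto
        then show ?thesis unfolding degree_def using card_Un_le le_trans by blast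
      qed
      finally show "x + y - 1 \<le> degree (E - H) v" using H(2)[of v] xy(3) by linarith
    qed
    then obtain c where c: "hamilton_cycle V (E - H) c" by blast
    have "hamilton_cycle V E c" using c by (auto simp: hamilton_cycle_def)
    moreover have new: "cycle_edges c \<inter> cycle_edges (C i) = {}" if "i < m" for i
      using c that by (auto simp: hamilton_cycle_def H_def)
    moreover have "cycle_edges (C i) \<inter> cycle_edges c = {}" if "i < m" for i
      using new[OF that] by blast
    ultimately show ?case using C disj
      by (intro exI[of _ "C(m := c)"]) (auto simp: less_Suc_eq)
  qed
  then show ?thesis by blast
qed

end
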